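(* Let $\Gamma$ be a commutative group and $T$ a commutative ternary $\Gamma$-semiring. Let $X=\mathrm{Spec}_\Gamma(T)$ be finite. Then $X$ is connected (as a topological space) if and only if $\lambda_2(L_X)>0$.
   Context: A commutative semiring is a tuple $(T,+,\cdot,0,1)$ with $(T,+,0)$ and $(T,\cdot,1)$ commutative monoids, multiplication distributing over addition, and $0\cdot x=x\cdot 0=0$. A commutative ternary $\Gamma$-semiring $(T,u)$ is a commutative semiring $T$ with a group homomorphism $u:\Gamma\to T^\times$, $\gamma\mapsto u_\gamma$, together with the operations $\{a\,b\,c\}_\gamma:=a b c u_\gamma$. A $\Gamma$-ideal of $T$ is a subset $I$ which is a submonoid of $(T,+,0)$ and satisfies $\{a\,b\,c\}_\gamma\in I$ for all $a\in I$, $b,c\in T$, $\gamma\in\Gamma$. A proper $\Gamma$-ideal $P$ is prime if $\{a\,b\,c\}_\gamma\in P$ implies $a\in P$ or $b\in P$ or $c\in P$, for all $a,b,c\in T$, $\gamma\in\Gamma$. $\mathrm{Spec}_\Gamma(T)$ is the set of prime $\Gamma$-ideals with the topology whose closed sets are $V(I)=\{P\mid I\subseteq P\}$ for $\Gamma$-ideals $I$. For finite $X=\mathrm{Spec}_\Gamma(T)$, the specialization graph $G_X$ is the undirected graph with vertex set $X$ and an edge between distinct $P\ne Q$ iff $P\subseteq Q$ or $Q\subseteq P$. The canonical Laplacian is $L_X:=D_X-A_X$, with $A_X$ the adjacency matrix and $D_X$ the diagonal degree matrix of $G_X$. Its eigenvalues, counted with multiplicity, are written $0=\lambda_1\le\lambda_2\le\cdots\le\lambda_n$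 with $n=|X|$, and $\lambda_2(L_X)$ is the second of these. *)

theory Defs
  imports
    "HOL-Algebra.Ring"
    "HOL-Analysis.Abstract_Topology"
    "HOL-Library.Extended_Real"
    "Jordan_Normal_Form.Char_Poly"
begin

section \<open>Commutative ternary \<open>\<Gamma>\<close>-semirings\<close>

text \<open>The one-element semiring is not excluded: \<^locale>\<open>semiring\<close> does not require
  \<open>\<zero> \<noteq> \<one>\<close>.\<close>

locale ternary_gamma_semiring =
  semiring T + comm_monoid T + Gamma: comm_group G
  for T :: "('a, 'm) ring_scheme" (structure)
    and G :: "('g, 'n) monoid_scheme"
    and u :: "'g \<Rightarrow> 'a" +
  assumes u_hom: "u \<in> hom G (units_of T)"

definition tern :: "('a, 'm) ring_scheme \<Rightarrow> ('g \<Rightarrow> 'a) \<Rightarrow> 'g \<Rightarrow> 'a \<Rightarrow> 'a \<Rightarrow> 'a \<Rightarrow> 'a" where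
  "tern T u g a b c = a \<otimes>\<^bsub>T\<^esub> b \<otimes>\<^bsub>T\<^esub> c \<otimes>\<^bsub>T\<^esub> u g"

definition gamma_ideal ::
  "('a, 'm) ring_scheme \<Rightarrow> ('g, 'n) monoid_scheme \<Rightarrow> ('g \<Rightarrow> 'a) \<Rightarrow> 'a set \<Rightarrow> bool" where
  "gamma_ideal T G u I \<longleftrightarrow>
     submonoid I (add_monoid T) \<and>
     (\<forall>a\<in>I. \<forall>b\<in>carrier T. \<forall>c\<in>carrier T. \<forall>g\<in>carrier G. tern T u g a b c \<in> I)"

definition prime_gamma_ideal ::
  "('a, 'm) ring_scheme \<Rightarrow> ('g, 'n) monoid_scheme \<Rightarrow> ('g \<Rightarrow> 'a) \<Rightarrow> 'a set \<Rightarrow> bool" where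
  "prime_gamma_ideal T G u P \<longleftrightarrow>
     gamma_ideal T G u P \<and> P \<noteq> carrier T \<and>
     (\<forall>a\<in>carrier T. \<forall>b\<in>carrier T. \<forall>c\<in>carrier T. \<forall>g\<in>carrier G.
        tern T u g a b c \<in> P \<longrightarrow> a \<in> P \<or> b \<in> P \<or> c \<in> P)"

definition gamma_Spec ::
  "('a, 'm) ring_scheme \<Rightarrow> ('g, 'n) monoid_scheme \<Rightarrow> ('g \<Rightarrow> 'a) \<Rightarrow> 'a set set" where
  "gamma_Spec T G u = {P. prime_gamma_ideal T G u P}"

definition gamma_V ::
  "('a, 'm) ring_scheme \<Rightarrow> ('g, 'n) monoid_scheme \<Rightarrow> ('g \<Rightarrow> 'a) \<Rightarrow> 'a set \<Rightarrow> 'a set set" where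
  "gamma_V T G u I = {P \<in> gamma_Spec T G u. I \<subseteq> P}"

text \<open>The defining predicate is shown to be an \<^const>\<open>istopology\<close> below, and the closed sets
  are shown to be exactly the sets \<open>V(I)\<close>.\<close>

definition gamma_Spec_topology ::
  "('a, 'm) ring_scheme \<Rightarrow> ('g, 'n) monoid_scheme \<Rightarrow> ('g \<Rightarrow> 'a) \<Rightarrow> 'a set topology" where
  "gamma_Spec_topology T G u =
     topology (\<lambda>U. \<exists>I. gamma_ideal T G u I \<and> U = gamma_Spec T G u - gamma_V T G u I)"

context ternary_gamma_semiring
begin

lemma u_closed: "g \<in> carrier G \<Longrightarrow> u g \<in> carrier T"
  using u_hom by (auto simp: hom_def units_of_def Units_def)

lemma u_one: "u \<one>\<^bsub>G\<^esub> = \<one>"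
  using hom_one[OF u_hom Gamma.is_group units_group] by (simp add: units_of_one)

lemma tern_closed:
  "\<lbrakk>a \<in> carrier T; b \<in> carrier T; c \<in> carrier T; g \<in> carrier G\<rbrakk> \<Longrightarrow> tern T u g a b c \<in> carrier T"
  by (simp add: tern_def u_closed)

lemma gamma_ideal_subset: "gamma_ideal T G u I \<Longrightarrow> I \<subseteq> carrier T"
  unfolding gamma_ideal_def using submonoid.subset by fastforce

lemma gamma_ideal_carrier: "gamma_ideal T G u (carrier T)"
  unfolding gamma_ideal_def by (auto intro!: submonoid.intro tern_closed)

lemma gamma_ideal_zero: "gamma_ideal T G u {\<zero>}"
  unfolding gamma_ideal_def by (auto intro!: submonoid.intro simp: tern_def u_closed)

lemma gamma_ideal_mult:
  assumes "gamma_ideal T G u I" "a \<in> I" "b \<in> carrier T"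
  shows "a \<otimes> b \<in> I"
proof -
  have "tern T u \<one>\<^bsub>G\<^esub> a b \<one> \<in> I"
    using assms unfolding gamma_ideal_def by auto
  then show ?thesis
    using assms gamma_ideal_subset[OF assms(1)] by (auto simp: tern_def u_one)
qed

lemma gamma_ideal_Inter:
  assumes "\<I> \<noteq> {}" "\<And>I. I \<in> \<I> \<Longrightarrow> gamma_ideal T G u I"
  shows "gamma_ideal T G u (\<Inter>\<I>)"
proof -
  have sm: "submonoid I (add_monoid T)" if "I \<in> \<I>" for I
    using assms(2)[OF that] unfolding gamma_ideal_def by blast
  have "submonoid (\<Inter>\<I>) (add_monoid T)"
  proof (rule submonoid.intro)
    show "\<Inter>\<I> \<subseteq> carrier (add_monoid T)"
      using assms(1) submonoid.subset[OF sm] by blast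
    show "x \<otimes>\<^bsub>add_monoid T\<^esub> y \<in> \<Inter>\<I>" if "x \<in> \<Inter>\<I>" "y \<in> \<Inter>\<I>" for x y
      using submonoid.m_closed[OF sm] that by blast
    show "\<one>\<^bsub>add_monoid T\<^esub> \<in> \<Inter>\<I>"
      using submonoid.one_closed[OF sm] by blast
  qed
  then show ?thesis
    using assms(2) unfolding gamma_ideal_def by blast
qed

lemma one_notin_prime:
  assumes "prime_gamma_ideal T G u P" shows "\<one> \<notin> P"
proof
  assume "\<one> \<in> P"
  moreover have id: "gamma_ideal T G u P"
    using assms by (simp add: prime_gamma_ideal_def)
  ultimately have "carrier T \<subseteq> P"
    using gamma_ideal_mult[OF id] by (metis l_one subsetI)
  with gamma_ideal_subset[OF id] assms show False
    by (auto simp: prime_gamma_ideal_def)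
qed

lemma gamma_V_Int:
  assumes I: "gamma_ideal T G u I" and J: "gamma_ideal T G u J"
  shows "gamma_V T G u (I \<inter> J) = gamma_V T G u I \<union> gamma_V T G u J"
proof
  show "gamma_V T G u (I \<inter> J) \<subseteq> gamma_V T G u I \<union> gamma_V T G u J"
  proof
    fix P assume P: "P \<in> gamma_V T G u (I \<inter> J)"
    then have pr: "prime_gamma_ideal T G u P" and sub: "I \<inter> J \<subseteq> P"
      by (auto simp: gamma_V_def gamma_Spec_def)
    show "P \<in> gamma_V T G u I \<union> gamma_V T G u J"
    proof (rule ccontr)
      assume "P \<notin> gamma_V T G u I \<union> gamma_V T G u J"
      then obtain a b where ab: "a \<in> I" "a \<notin> P" "b \<in> J" "b \<notin> P"
        using pr by (auto simp: gamma_V_def gamma_Spec_def)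
      have c: "a \<in> carrier T" "b \<in> carrier T"
        using ab gamma_ideal_subset I J by blast+
      have "a \<otimes> b \<in> I" "b \<otimes> a \<in> J"
        using gamma_ideal_mult I J ab c by blast+
      then have "a \<otimes> b \<in> P"
        using sub c by (auto simp: m_comm)
      then have "tern T u \<one>\<^bsub>G\<^esub> a b \<one> \<in> P"
        using c by (simp add: tern_def u_one)
      then show False
        using pr c ab one_notin_prime[OF pr] unfolding prime_gamma_ideal_def
        by (meson Gamma.one_closed one_closed)
    qed
  qed
qed (auto simp: gamma_V_def)

lemma istopology_gamma_Spec:
  "istopology (\<lambda>U. \<exists>I. gamma_ideal T G u I \<and> U = gamma_Spec T G u - gamma_V T G u I)"
  unfolding istopology_def
proof (intro conjI allI impI)
  fix A B
  assume "\<exists>I. gamma_ideal T G u I \<and> A = gamma_Spec T G u - gamma_V T G u I"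
    and "\<exists>I. gamma_ideal T G u I \<and> B = gamma_Spec T G u - gamma_V T G u I"
  then obtain I J where IJ: "gamma_ideal T G u I" "A = gamma_Spec T G u - gamma_V T G u I"
    "gamma_ideal T G u J" "B = gamma_Spec T G u - gamma_V T G u J"
    by blast
  have "gamma_ideal T G u (I \<inter> J)"
    using gamma_ideal_Inter[of "{I, J}"] IJ by auto
  moreover have "A \<inter> B = gamma_Spec T G u - gamma_V T G u (I \<inter> J)"
    using IJ gamma_V_Int by blast
  ultimately show "\<exists>I. gamma_ideal T G u I \<and> A \<inter> B = gamma_Spec T G u - gamma_V T G u I"
    by blast
next
  fix \<K> :: "'a set set set"
  assume K: "\<forall>K\<in>\<K>. \<exists>I. gamma_ideal T G u I \<and> K = gamma_Spec T G u - gamma_V T G u I"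
  then obtain f where f: "\<And>K. K \<in> \<K> \<Longrightarrow> gamma_ideal T G u (f K)"
    "\<And>K. K \<in> \<K> \<Longrightarrow> K = gamma_Spec T G u - gamma_V T G u (f K)"
    by metis
  define \<I> where "\<I> = {I. gamma_ideal T G u I \<and> \<Union>(f ` \<K>) \<subseteq> I}"
  have sub: "f K \<subseteq> carrier T" if "K \<in> \<K>" for K
    using gamma_ideal_subset f(1) that by blast
  have car: "carrier T \<in> \<I>"
    using gamma_ideal_carrier sub unfolding \<I>_def by blast
  have id: "gamma_ideal T G u (\<Inter>\<I>)"
    using car by (intro gamma_ideal_Inter) (auto simp: \<I>_def)
  have "P \<in> \<Union>\<K> \<longleftrightarrow> P \<in> gamma_Spec T G u - gamma_V T G u (\<Inter>\<I>)" for P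
  proof -
    have 1: "P \<in> K \<longleftrightarrow> P \<in> gamma_Spec T G u \<and> \<not> f K \<subseteq> P" if "K \<in> \<K>" for K
      using f(2)[OF that] by (auto simp: gamma_V_def)
    have 2: "(\<forall>K\<in>\<K>. f K \<subseteq> P) \<longleftrightarrow> \<Inter>\<I> \<subseteq> P" if "P \<in> gamma_Spec T G u"
      using that unfolding \<I>_def gamma_Spec_def prime_gamma_ideal_def by blast
    show ?thesis
      using 1 2 unfolding gamma_V_def by blast
  qed
  then have "\<Union>\<K> = gamma_Spec T G u - gamma_V T G u (\<Inter>\<I>)"
    by blast
  with id show "\<exists>I. gamma_ideal T G u I \<and> \<Union>\<K> = gamma_Spec T G u - gamma_V T G u I"
    by blast
qed

lemma openin_gamma_Spec:
  "openin (gamma_Spec_topology T G u) U \<longleftrightarrow>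
     (\<exists>I. gamma_ideal T G u I \<and> U = gamma_Spec T G u - gamma_V T G u I)"
  unfolding gamma_Spec_topology_def topology_inverse'[OF istopology_gamma_Spec] ..

lemma topspace_gamma_Spec: "topspace (gamma_Spec_topology T G u) = gamma_Spec T G u"
proof
  show "topspace (gamma_Spec_topology T G u) \<subseteq> gamma_Spec T G u"
    unfolding topspace_def openin_gamma_Spec by blast
  have "gamma_V T G u (carrier T) = {}"
    using gamma_ideal_subset by (auto simp: gamma_V_def gamma_Spec_def prime_gamma_ideal_def)
  then have "openin (gamma_Spec_topology T G u) (gamma_Spec T G u)"
    unfolding openin_gamma_Spec using gamma_ideal_carrier by blast
  then show "gamma_Spec T G u \<subseteq> topspace (gamma_Spec_topology T G u)"
    by (rule openin_subset)
qed

lemma closedin_gamma_Spec: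
  "closedin (gamma_Spec_topology T G u) C \<longleftrightarrow> (\<exists>I. gamma_ideal T G u I \<and> C = gamma_V T G u I)"
proof -
  have "gamma_V T G u I \<subseteq> gamma_Spec T G u" for I
    by (auto simp: gamma_V_def)
  then show ?thesis
    unfolding closedin_def topspace_gamma_Spec openin_gamma_Spec
    by (metis double_diff order_refl)
qed

end

section \<open>The specialization graph and its Laplacian\<close>

definition spec_adj :: "'a set \<Rightarrow> 'a set \<Rightarrow> bool" where
  "spec_adj P Q \<longleftrightarrow> P \<noteq> Q \<and> (P \<subseteq> Q \<or> Q \<subseteq> P)"

text \<open>Matrices are indexed by \<open>{0..<n}\<close>, so the vertex set is given by a list \<open>ps\<close> of its
  distinct elements. Another choice of \<open>ps\<close> conjugates the matrices by a permutation matrix.\<close>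

definition adjacency_mat :: "'a set list \<Rightarrow> real mat" where
  "adjacency_mat ps =
     mat (length ps) (length ps) (\<lambda>(i, j). if spec_adj (ps ! i) (ps ! j) then 1 else 0)"

definition degree_mat :: "'a set list \<Rightarrow> real mat" where
  "degree_mat ps =
     mat (length ps) (length ps)
       (\<lambda>(i, j). if i = j then real (card {Q \<in> set ps. spec_adj (ps ! i) Q}) else 0)"

definition laplacian_mat :: "'a set list \<Rightarrow> real mat" where
  "laplacian_mat ps = degree_mat ps - adjacency_mat ps"

definition sorted_eigenvalues :: "real mat \<Rightarrow> real list" where
  "sorted_eigenvalues A = sorted_list_of_multiset (proots (char_poly A))"

text \<open>List positions start at \<open>0\<close>, so \<open>\<lambda>\<^sub>2\<close> is at position \<open>1\<close>. If there are fewer than two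
  eigenvalues, \<open>\<lambda>\<^sub>2\<close> is \<open>\<infinity>\<close>, the infimum of the empty set.\<close>

definition lambda2 :: "real mat \<Rightarrow> ereal" where
  "lambda2 A =
     (let es = sorted_eigenvalues A in if 2 \<le> length es then ereal (es ! 1) else \<infinity>)"

end

theory Submission
  imports Defs
begin

text \<open>
  Both sides of the equivalence say that the specialization graph \<open>G\<close> of the spectrum \<open>X\<close> is
  connected, in the form that a real function which does not change along any edge is constant.

  On the topological side, every \<open>V(I)\<close> is an upper set for inclusion. As \<open>X\<close> is finite, every
  upper set is conversely a finite union of sets \<open>V(P)\<close>, hence closed. A set is therefore clopen
  iff it is closed under inclusion in both directions, that is, iff no edge of \<open>G\<close> leaves it
  (\<open>clopen_gamma_Spec_finite_iff\<close>). Such sets are the level sets of the functions that do not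
  change along edges, which gives \<open>connected_gamma_Spec_iff\<close>.

  On the spectral side, the Laplacian \<open>L\<close> has the quadratic form
  \<open>f \<bullet> L f = \<Sum> (f x - f y)\<^sup>2\<close>, summed over the edges (\<open>laplacian_Dirichlet_form\<close>). So its
  eigenvalues are nonnegative, and its kernel consists of the functions that do not change along
  edges. Hence \<open>\<lambda>\<^sub>2 > 0\<close> iff \<open>0\<close> is not a repeated root of the characteristic polynomial, and it
  remains to see that it is repeated iff the kernel contains more than the constants.

  This last step, \<open>order_zero_char_poly_ge_2_iff\<close>, is about the algebraic multiplicity, and it
  holds for every square matrix whose row and column sums vanish, over any
  field of characteristic \<open>0\<close>. With the constant vector as the first basis vector, the first
  column of the matrix becomes \<open>0\<close>, so its characteristic polynomial is \<open>x\<close> times that of a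
  smaller block \<open>B\<close>. A null vector of \<open>B\<close> amounts to a vector with first entry \<open>0\<close> which
  the original matrix maps to a constant one. That constant is \<open>0\<close>, because the entries of the image add up to \<open>0\<close>.
\<close>

section \<open>The multiplicity of the eigenvalue zero\<close>

lemma sum_unit_shear_left:
  fixes g :: "nat \<Rightarrow> 'a::comm_ring_1"
  assumes "i < n"
  shows "(\<Sum>k<n. (if i = k then 1 else if k = 0 then c else 0) * g k)
       = g i + (if i = 0 then 0 else c * g 0)"
proof -
  have "(\<Sum>k<n. (if i = k then 1 else if k = 0 then c else 0) * g k)
      = (\<Sum>k<n. (if i = k then g k else 0) + (if k = 0 then (if i = 0 then 0 else c * g k) else 0))"
    by (intro sum.cong) auto
  also have "\<dots> = g i + (if i = 0 then 0 else c * g 0)"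
    using assms by (simp add: sum.distrib)
  finally show ?thesis .
qed

text \<open>For \<open>c = 1\<close> this is the base change that replaces the first standard basis vector by the
  constant vector \<open>1\<close>, and \<open>c = - 1\<close> gives its inverse.\<close>

definition unit_shear :: "nat \<Rightarrow> 'a::comm_ring_1 \<Rightarrow> 'a mat" where
  "unit_shear n c = mat n n (\<lambda>(i, j). if i = j then 1 else if j = 0 then c else 0)"

lemma unit_shear_carrier [simp]: "unit_shear n c \<in> carrier_mat n n"
  by (simp add: unit_shear_def)

lemma unit_shear_mult_index:
  assumes "A \<in> carrier_mat n m" "i < n" "j < m"
  shows "(unit_shear n c * A) $$ (i, j) = A $$ (i, j) + (if i = 0 then 0 else c * A $$ (0, j))"
proof -
  have "(unit_shear n c * A) $$ (i, j)
      = (\<Sum>k<n. (if i = k then 1 else if k = 0 then c else 0) * A $$ (k, j))"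
    using assms by (simp add: unit_shear_def scalar_prod_def lessThan_atLeast0)
  then show ?thesis
    unfolding sum_unit_shear_left[OF assms(2)] .
qed

lemma unit_shear_inverse: "unit_shear n c * unit_shear n (- c) = 1\<^sub>m n"
proof (rule eq_matI)
  fix i j assume ij: "i < dim_row (1\<^sub>m n :: 'a mat)" "j < dim_col (1\<^sub>m n :: 'a mat)"
  then show "(unit_shear n c * unit_shear n (- c)) $$ (i, j) = 1\<^sub>m n $$ (i, j)"
    by (subst unit_shear_mult_index[where m = n]) (auto simp: unit_shear_def)
qed (auto simp: unit_shear_def)

lemma mult_unit_shear_index:
  fixes A :: "'a::comm_ring_1 mat"
  assumes "A \<in> carrier_mat m n" "i < m" "j < n"
  shows "(A * unit_shear n 1) $$ (i, j) = (if j = 0 then (\<Sum>k<n. A $$ (i, k)) else A $$ (i, j))"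
proof -
  have "(A * unit_shear n 1) $$ (i, j)
      = (\<Sum>k<n. A $$ (i, k) * (if k = j then 1 else if j = 0 then 1 else 0))"
    using assms by (simp add: unit_shear_def scalar_prod_def lessThan_atLeast0)
  also have "\<dots> = (if j = 0 then (\<Sum>k<n. A $$ (i, k)) else A $$ (i, j))"
    using assms by (cases "j = 0") (auto intro!: sum.cong simp: if_distrib[of "(*) _"] cong: if_cong)
  finally show ?thesis .
qed

text \<open>The constant vector is in the kernel, so conjugation by the base change \<^const>\<open>unit_shear\<close>
  makes the first column \<open>0\<close>. The block that remains after deleting the first row and column is
  the action of the matrix on the quotient by the constants: subtracting row \<open>0\<close> normalizes the
  representative of each class to have first entry \<open>0\<close>.\<close>

lemma char_poly_zero_row_sums:
  fixes A :: "'a::idom mat"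
  assumes A: "A \<in> carrier_mat (Suc n) (Suc n)"
    and rows: "\<And>i. i < Suc n \<Longrightarrow> (\<Sum>j<Suc n. A $$ (i, j)) = 0"
  shows "char_poly A
       = monom 1 1 * char_poly (mat n n (\<lambda>(i, j). A $$ (Suc i, Suc j) - A $$ (0, Suc j)))"
    (is "_ = _ * char_poly ?B")
proof -
  let ?P = "unit_shear (Suc n) (1::'a)" and ?Q = "unit_shear (Suc n) (- 1::'a)"
  define M where "M = ?Q * (A * ?P)"
  have AP: "A * ?P \<in> carrier_mat (Suc n) (Suc n)"
    using A by auto
  have M: "M \<in> carrier_mat (Suc n) (Suc n)"
    unfolding M_def using AP unit_shear_carrier by (rule mult_carrier_mat[rotated])
  have QP: "?P * ?Q = 1\<^sub>m (Suc n)" "?Q * ?P = 1\<^sub>m (Suc n)"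
    using unit_shear_inverse[of "Suc n" "1::'a"] unit_shear_inverse[of "Suc n" "- 1::'a"] by auto
  have "M = ?Q * A * ?P"
    unfolding M_def by (rule assoc_mult_mat[symmetric, OF unit_shear_carrier A unit_shear_carrier])
  then have "similar_mat M A"
    using QP A M by (intro similar_matI[where P = ?Q and Q = ?P and n = "Suc n"]) auto
  then have "char_poly A = char_poly M"
    by (simp add: char_poly_similar)
  also have "\<dots> = monom 1 1 * char_poly (mat_delete M 0 0)"
  proof (rule char_poly_0_column[OF _ M])
    fix j assume j: "j < Suc n"
    show "M $$ (j, 0) = 0"
      unfolding M_def unit_shear_mult_index[OF AP j zero_less_Suc]
      using j rows by (simp add: mult_unit_shear_index[OF A] del: sum.lessThan_Suc)
  qed simp
  also have "mat_delete M 0 0 = ?B"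
  proof (rule eq_matI)
    fix i j assume "i < dim_row ?B" "j < dim_col ?B"
    then have ij: "Suc i < Suc n" "Suc j < Suc n"
      by auto
    then have "mat_delete M 0 0 $$ (i, j) = M $$ (Suc i, Suc j)"
      using M by (simp add: mat_delete_def)
    also have "\<dots> = A $$ (Suc i, Suc j) - A $$ (0, Suc j)"
      unfolding M_def unit_shear_mult_index[OF AP ij]
      using ij by (simp add: mult_unit_shear_index[OF A])
    finally show "mat_delete M 0 0 $$ (i, j) = ?B $$ (i, j)"
      using ij by simp
  qed (use M in \<open>auto simp: mat_delete_def\<close>)
  finally show ?thesis .
qed

text \<open>Vanishing row sums alone do not suffice: a nilpotent Jordan block could sit above the constant
  vector. The column sums exclude this, since they force every image vector to have entries
  adding up to \<open>0\<close>, and in characteristic \<open>0\<close> no nonzero constant vector does.\<close>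

lemma order_zero_char_poly_ge_2_iff:
  fixes A :: "'a::field_char_0 mat"
  assumes A: "A \<in> carrier_mat n n"
    and rows: "\<And>i. i < n \<Longrightarrow> (\<Sum>j<n. A $$ (i, j)) = 0"
    and cols: "\<And>j. j < n \<Longrightarrow> (\<Sum>i<n. A $$ (i, j)) = 0"
  shows "2 \<le> order 0 (char_poly A) \<longleftrightarrow>
    (\<exists>f. (\<forall>i<n. (\<Sum>j<n. A $$ (i, j) * f j) = 0) \<and> (\<exists>i<n. \<exists>j<n. f i \<noteq> f j))"
    (is "_ \<longleftrightarrow> ?kernel")
proof (cases n)
  case 0
  have "char_poly A \<noteq> 0" "degree (char_poly A) = 0"
    using degree_monic_char_poly[OF A] 0 by auto
  then have "order 0 (char_poly A) = 0"
    using order_degree[of "char_poly A" 0] by simp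
  then show ?thesis
    using 0 by simp
next
  case (Suc m)
  define B where "B = mat m m (\<lambda>(i, j). A $$ (Suc i, Suc j) - A $$ (0, Suc j))"
  have B: "B \<in> carrier_mat m m"
    by (simp add: B_def)
  have q0: "char_poly B \<noteq> 0"
    using degree_monic_char_poly[OF B] by auto
  have "char_poly A = [:- 0, 1:] ^ 1 * char_poly B"
    using char_poly_zero_row_sums[of A m] A rows unfolding Suc B_def by (simp add: monom_altdef)
  moreover have "order 0 ([:- 0, 1:] ^ 1 * char_poly B) = 1 + order 0 (char_poly B)"
    using q0 order_power_n_n[of "0::'a" 1] by (subst order_mult) auto
  ultimately have "order 0 (char_poly A) = 1 + order 0 (char_poly B)"
    by (simp only:)
  then have "2 \<le> order 0 (char_poly A) \<longleftrightarrow> order 0 (char_poly B) \<noteq> 0"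
    by arith
  also have "\<dots> \<longleftrightarrow> eigenvalue B 0"
    using order_root[of "char_poly B" 0] q0 eigenvalue_root_char_poly[OF B] by simp
  also have "\<dots> \<longleftrightarrow> ?kernel"
  proof
    assume "eigenvalue B 0"
    then obtain v where v: "v \<in> carrier_vec m" "v \<noteq> 0\<^sub>v m" "B *\<^sub>v v = 0 \<cdot>\<^sub>v v"
      using B by (auto simp: eigenvalue_def eigenvector_def)
    \<comment> \<open>The null vector of \<open>B\<close>, lifted to the representative with first entry \<open>0\<close>.\<close>
    define f where "f = (\<lambda>i. case i of 0 \<Rightarrow> 0 | Suc k \<Rightarrow> v $ k)"
    define r where "r i = (\<Sum>j<n. A $$ (i, j) * f j)" for i
    have r_Suc: "r i = (\<Sum>j<m. A $$ (i, Suc j) * v $ j)" for i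
      unfolding r_def Suc sum.lessThan_Suc_shift by (simp add: f_def)
    have "r (Suc i) = r 0" if i: "i < m" for i
    proof -
      have "0 = (B *\<^sub>v v) $ i"
        using v i by simp
      also have "\<dots> = (\<Sum>j<m. (A $$ (Suc i, Suc j) - A $$ (0, Suc j)) * v $ j)"
        using v(1) i by (simp add: B_def scalar_prod_def lessThan_atLeast0)
      also have "\<dots> = r (Suc i) - r 0"
        by (simp add: r_Suc left_diff_distrib sum_subtractf)
      finally show ?thesis by simp
    qed
    then have r_const: "r i = r 0" if "i < n" for i
      using that Suc by (cases i) auto
    \<comment> \<open>The entries of the image of \<open>f\<close> are equal, and they add up to \<open>0\<close> because the columns do.\<close>
    have "(\<Sum>i<n. r i) = (\<Sum>i<n. r 0)"
      by (rule sum.cong[OF refl], rule r_const) simp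
    then have "of_nat n * r 0 = (\<Sum>i<n. r i)"
      by simp
    also have "\<dots> = (\<Sum>j<n. \<Sum>i<n. A $$ (i, j) * f j)"
      unfolding r_def by (rule sum.swap)
    also have "\<dots> = 0"
      using cols by (simp flip: sum_distrib_right)
    finally have "r 0 = 0"
      using Suc by (simp del: of_nat_Suc)
    moreover obtain k where "k < m" "v $ k \<noteq> 0"
      using v by (metis carrier_vecD eq_vecI index_zero_vec)
    then have "f (Suc k) \<noteq> f 0" "Suc k < n" "0 < n"
      using Suc by (auto simp: f_def)
    ultimately show ?kernel
      using r_const unfolding r_def by metis
  next
    assume ?kernel
    then obtain f i j where f: "\<And>i. i < n \<Longrightarrow> (\<Sum>j<n. A $$ (i, j) * f j) = 0"
      and ij: "i < n" "j < n" "f i \<noteq> f j"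
      by blast
    \<comment> \<open>Subtracting the constant \<open>f 0\<close> keeps the function in the kernel, as row sums vanish, and
      makes its first entry \<open>0\<close>.\<close>
    define v where "v = vec m (\<lambda>k. f (Suc k) - f 0)"
    have *: "(\<Sum>k<m. A $$ (i, Suc k) * (f (Suc k) - f 0)) = 0" if "i < n" for i
    proof -
      have "(\<Sum>k<m. A $$ (i, Suc k) * (f (Suc k) - f 0)) = (\<Sum>k<n. A $$ (i, k) * (f k - f 0))"
        unfolding Suc sum.lessThan_Suc_shift by simp
      also have "\<dots> = (\<Sum>k<n. A $$ (i, k) * f k) - (\<Sum>k<n. A $$ (i, k)) * f 0"
        by (simp add: right_diff_distrib sum_subtractf sum_distrib_right)
      also have "\<dots> = 0"
        using f rows that by simp
      finally show ?thesis .
    qed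
    have "B *\<^sub>v v = 0 \<cdot>\<^sub>v v"
    proof (rule eq_vecI)
      fix i assume "i < dim_vec (0 \<cdot>\<^sub>v v)"
      then have i: "i < m"
        by (simp add: v_def)
      then have "(B *\<^sub>v v) $ i
          = (\<Sum>k<m. (A $$ (Suc i, Suc k) - A $$ (0, Suc k)) * (f (Suc k) - f 0))"
        by (simp add: B_def v_def scalar_prod_def lessThan_atLeast0)
      also have "\<dots> = 0"
        using *[of "Suc i"] *[of 0] i Suc by (simp add: left_diff_distrib sum_subtractf)
      finally show "(B *\<^sub>v v) $ i = (0 \<cdot>\<^sub>v v) $ i"
        using i by (simp add: v_def)
    qed (simp add: B_def v_def)
    moreover have "v \<noteq> 0\<^sub>v m"
    proof
      assume "v = 0\<^sub>v m"
      then have "f (Suc k) = f 0" if "k < m" for k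
        using that unfolding v_def by (metis eq_iff_diff_eq_0 index_vec index_zero_vec(1))
      then have "f k = f 0" if "k < n" for k
        using that Suc by (cases k) auto
      then show False
        using ij by metis
    qed
    ultimately show "eigenvalue B 0"
      using B unfolding eigenvalue_def eigenvector_def by (intro exI[of _ v]) (simp add: v_def)
  qed
  finally show ?thesis .
qed

text \<open>If there are fewer than two real roots then \<^const>\<open>lambda2\<close> is \<open>\<infinity>\<close> and \<open>0\<close> is at most a
  simple root, so both sides hold.\<close>

lemma lambda2_pos_iff:
  assumes "char_poly A \<noteq> 0"
    and nonneg: "\<And>k. poly (char_poly A) k = 0 \<Longrightarrow> 0 \<le> k"
  shows "lambda2 A > 0 \<longleftrightarrow> order 0 (char_poly A) < 2"
proof -
  define es where "es = sorted_eigenvalues A"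
  have mset: "mset es = proots (char_poly A)" and sorted: "sorted es"
    by (simp_all add: es_def sorted_eigenvalues_def)
  have order: "order 0 (char_poly A) = count_list es 0"
    using assms by (metis count_mset count_proots mset)
  have "set es = {k. poly (char_poly A) k = 0}"
    using assms by (metis mset set_count_proots set_mset_mset)
  then have pos: "\<forall>k\<in>set es. 0 \<le> k"
    using nonneg by blast
  consider "es = []" | a where "es = [a]" | a b bs where "es = a # b # bs"
    by (metis list.exhaust)
  then show ?thesis
  proof cases
    case 3
    have "count_list bs 0 = 0" if "0 < b"
      using that sorted 3 by (fastforce simp: count_list_0_iff)
    then show ?thesis
      unfolding order using sorted pos 3
      by (auto simp: lambda2_def simp flip: es_def)
  qed (auto simp: order lambda2_def simp flip: es_def)
qed

section \<open>The Dirichlet form of the Laplacian\<close>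

text \<open>For a symmetric \<open>E\<close> this is the usual connectedness of a graph, with the empty graph counted as
  connected: the indicator function of a component does not change along edges. Stated with real functions
  it speaks directly about the kernel of the Laplacian.\<close>

definition graph_connected :: "'v set \<Rightarrow> ('v \<Rightarrow> 'v \<Rightarrow> bool) \<Rightarrow> bool" where
  "graph_connected V E \<longleftrightarrow>
     (\<forall>f :: 'v \<Rightarrow> real. (\<forall>x\<in>V. \<forall>y\<in>V. E x y \<longrightarrow> f x = f y) \<longrightarrow> (\<forall>x\<in>V. \<forall>y\<in>V. f x = f y))"

text \<open>Exchanging \<open>i\<close> and \<open>j\<close> and adding the two versions of the sum completes the square. The sum on
  the right counts every unordered pair twice, whence the factor \<open>2\<close>.\<close>

lemma Dirichlet_form:
  fixes w :: "'i \<Rightarrow> 'i \<Rightarrow> real"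
  assumes "\<And>i j. w i j = w j i"
  shows "2 * (\<Sum>i\<in>I. f i * (\<Sum>j\<in>I. w i j * (f i - f j))) = (\<Sum>i\<in>I. \<Sum>j\<in>I. w i j * (f i - f j)\<^sup>2)"
proof -
  define S where "S = (\<Sum>i\<in>I. \<Sum>j\<in>I. f i * (w i j * (f i - f j)))"
  have "S = (\<Sum>i\<in>I. \<Sum>j\<in>I. f j * (w j i * (f j - f i)))"
    unfolding S_def by (rule sum.swap)
  then have "2 * S = (\<Sum>i\<in>I. \<Sum>j\<in>I. f i * (w i j * (f i - f j)) + f j * (w j i * (f j - f i)))"
    by (simp add: sum.distrib flip: S_def)
  also have "\<dots> = (\<Sum>i\<in>I. \<Sum>j\<in>I. w i j * (f i - f j)\<^sup>2)"
    by (intro sum.cong refl) (simp add: assms power2_eq_square algebra_simps)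
  finally show ?thesis
    by (simp add: S_def sum_distrib_left)
qed

lemma spec_adj_commute: "spec_adj P Q = spec_adj Q P"
  by (auto simp: spec_adj_def)

lemma laplacian_carrier: "laplacian_mat ps \<in> carrier_mat (length ps) (length ps)"
  by (auto simp: laplacian_mat_def adjacency_mat_def degree_mat_def intro: minus_carrier_mat)

lemma laplacian_symmetric:
  "i < length ps \<Longrightarrow> j < length ps \<Longrightarrow> laplacian_mat ps $$ (i, j) = laplacian_mat ps $$ (j, i)"
  by (auto simp: laplacian_mat_def adjacency_mat_def degree_mat_def spec_adj_commute)

context
  fixes ps :: "'a set list"
  assumes distinct: "distinct ps"
begin

lemma laplacian_apply:
  assumes i: "i < length ps"
  shows "(\<Sum>j<length ps. laplacian_mat ps $$ (i, j) * f j)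
       = (\<Sum>j<length ps. of_bool (spec_adj (ps ! i) (ps ! j)) * (f i - f j))"
proof -
  have "real (card {Q \<in> set ps. spec_adj (ps ! i) Q}) = (\<Sum>Q\<in>set ps. of_bool (spec_adj (ps ! i) Q))"
    by (simp add: Int_def)
  also have "\<dots> = (\<Sum>j<length ps. of_bool (spec_adj (ps ! i) (ps ! j)))"
    by (rule sum.reindex_bij_betw[OF bij_betw_nth, symmetric]) (use distinct in auto)
  finally have deg: "real (card {Q \<in> set ps. spec_adj (ps ! i) Q})
      = (\<Sum>j<length ps. of_bool (spec_adj (ps ! i) (ps ! j)))" .
  have "(\<Sum>j<length ps. laplacian_mat ps $$ (i, j) * f j)
      = (\<Sum>j<length ps. (if i = j then real (card {Q \<in> set ps. spec_adj (ps ! i) Q}) * f j else 0)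
           - of_bool (spec_adj (ps ! i) (ps ! j)) * f j)"
    using i by (intro sum.cong)
      (auto simp: laplacian_mat_def adjacency_mat_def degree_mat_def left_diff_distrib)
  also have "\<dots> = real (card {Q \<in> set ps. spec_adj (ps ! i) Q}) * f i
      - (\<Sum>j<length ps. of_bool (spec_adj (ps ! i) (ps ! j)) * f j)"
    using i by (simp add: sum_subtractf)
  also have "\<dots> = (\<Sum>j<length ps. of_bool (spec_adj (ps ! i) (ps ! j)) * (f i - f j))"
    unfolding deg by (simp add: right_diff_distrib sum_subtractf sum_distrib_right)
  finally show ?thesis .
qed

lemma laplacian_Dirichlet_form:
  "2 * (\<Sum>i<length ps. f i * (\<Sum>j<length ps. laplacian_mat ps $$ (i, j) * f j))
   = (\<Sum>i<length ps. \<Sum>j<length ps. of_bool (spec_adj (ps ! i) (ps ! j)) * (f i - f j)\<^sup>2)"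
  using Dirichlet_form[of "\<lambda>i j. of_bool (spec_adj (ps ! i) (ps ! j))" f "{..<length ps}"]
  by (simp add: laplacian_apply spec_adj_commute)

lemma laplacian_row_sum:
  "i < length ps \<Longrightarrow> (\<Sum>j<length ps. laplacian_mat ps $$ (i, j)) = 0"
  using laplacian_apply[of i "\<lambda>_. 1"] by simp

text \<open>For an eigenvector \<open>v\<close>, the Dirichlet form at \<open>v\<close> is \<open>k\<close> times the squared length of \<open>v\<close>.\<close>

lemma laplacian_eigenvalue_nonneg:
  assumes "eigenvalue (laplacian_mat ps) k"
  shows "0 \<le> k"
proof -
  let ?n = "length ps" and ?L = "laplacian_mat ps"
  obtain v where v: "v \<in> carrier_vec ?n" "v \<noteq> 0\<^sub>v ?n" "?L *\<^sub>v v = k \<cdot>\<^sub>v v"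
    using assms laplacian_carrier[of ps] by (auto simp: eigenvalue_def eigenvector_def)
  obtain l where l: "l < ?n" "v $ l \<noteq> 0"
    using v by (metis carrier_vecD eq_vecI index_zero_vec)
  have Lv: "(\<Sum>j<?n. ?L $$ (i, j) * v $ j) = k * v $ i" if "i < ?n" for i
  proof -
    have "(\<Sum>j<?n. ?L $$ (i, j) * v $ j) = (?L *\<^sub>v v) $ i"
      using v(1) carrier_matD[OF laplacian_carrier[of ps]] that
      by (simp add: scalar_prod_def lessThan_atLeast0)
    then show ?thesis
      using v(1) that unfolding v(3) by simp
  qed
  have "k * (\<Sum>i<?n. (v $ i)\<^sup>2) = (\<Sum>i<?n. v $ i * (k * v $ i))"
    by (simp add: sum_distrib_left power2_eq_square mult_ac)
  then have "2 * (k * (\<Sum>i<?n. (v $ i)\<^sup>2)) = 2 * (\<Sum>i<?n. v $ i * (\<Sum>j<?n. ?L $$ (i, j) * v $ j))"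
    by (simp add: Lv)
  also have "\<dots> \<ge> 0"
    unfolding laplacian_Dirichlet_form by (intro sum_nonneg) auto
  finally have "0 \<le> k * (\<Sum>i<?n. (v $ i)\<^sup>2)"
    by simp
  moreover have "0 < (\<Sum>i<?n. (v $ i)\<^sup>2)"
    using l by (intro sum_pos2[of _ l]) auto
  ultimately show ?thesis
    by (simp add: zero_le_mult_iff)
qed

text \<open>On the kernel the Dirichlet form vanishes, and with it each of its nonnegative terms.\<close>

lemma laplacian_kernel_iff:
  "(\<forall>i<length ps. (\<Sum>j<length ps. laplacian_mat ps $$ (i, j) * f j) = 0) \<longleftrightarrow>
   (\<forall>i<length ps. \<forall>j<length ps. spec_adj (ps ! i) (ps ! j) \<longrightarrow> f i = f j)"
    (is "?kernel \<longleftrightarrow> ?const")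
proof
  let ?t = "\<lambda>i j. of_bool (spec_adj (ps ! i) (ps ! j)) * (f i - f j)\<^sup>2"
  assume ?kernel
  then have "(\<Sum>i<length ps. \<Sum>j<length ps. ?t i j) = 0"
    unfolding laplacian_Dirichlet_form[symmetric] by simp
  then have "\<forall>i<length ps. (\<Sum>j<length ps. ?t i j) = 0"
    by (subst (asm) sum_nonneg_eq_0_iff) (auto intro: sum_nonneg)
  then have "\<forall>i<length ps. \<forall>j<length ps. ?t i j = 0"
    by (subst (asm) sum_nonneg_eq_0_iff) auto
  then show ?const
    by auto
next
  assume ?const
  then show ?kernel
    by (auto simp: laplacian_apply intro!: sum.neutral)
qed

text \<open>The eigenvalues are nonnegative, so \<open>\<lambda>\<^sub>2 > 0\<close> says that \<open>0\<close> is at most a simple root, that is,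
  that the kernel has only constant functions. These live on the index set of \<open>ps\<close>, and
  connectedness is about functions on its entries.\<close>

theorem lambda2_laplacian_pos_iff:
  "lambda2 (laplacian_mat ps) > 0 \<longleftrightarrow> graph_connected (set ps) spec_adj"
proof -
  let ?n = "length ps" and ?L = "laplacian_mat ps"
  have "char_poly ?L \<noteq> 0"
    using degree_monic_char_poly[OF laplacian_carrier[of ps]] by auto
  moreover have "0 \<le> k" if "poly (char_poly ?L) k = 0" for k
    using that laplacian_eigenvalue_nonneg eigenvalue_root_char_poly[OF laplacian_carrier] by blast
  ultimately have "lambda2 ?L > 0 \<longleftrightarrow> \<not> 2 \<le> order 0 (char_poly ?L)"
    by (simp add: lambda2_pos_iff not_le)
  moreover have "2 \<le> order 0 (char_poly ?L) \<longleftrightarrow> (\<exists>f::nat \<Rightarrow> real.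
      (\<forall>i<?n. (\<Sum>j<?n. ?L $$ (i, j) * f j) = 0) \<and> (\<exists>i<?n. \<exists>j<?n. f i \<noteq> f j))"
  proof (rule order_zero_char_poly_ge_2_iff[OF laplacian_carrier laplacian_row_sum])
    fix j assume "j < ?n"
    then have "(\<Sum>i<?n. ?L $$ (i, j)) = (\<Sum>i<?n. ?L $$ (j, i))"
      by (intro sum.cong refl laplacian_symmetric) auto
    also have "\<dots> = 0"
      using \<open>j < ?n\<close> by (rule laplacian_row_sum)
    finally show "(\<Sum>i<?n. ?L $$ (i, j)) = 0" .
  qed
  ultimately have "lambda2 ?L > 0 \<longleftrightarrow> (\<forall>f::nat \<Rightarrow> real.
      (\<forall>i<?n. \<forall>j<?n. spec_adj (ps ! i) (ps ! j) \<longrightarrow> f i = f j) \<longrightarrow> (\<forall>i<?n. \<forall>j<?n. f i = f j))"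
    unfolding laplacian_kernel_iff by blast
  also have "\<dots> \<longleftrightarrow> graph_connected (set ps) spec_adj"
    unfolding graph_connected_def
  proof (intro iffI allI impI ballI)
    fix f :: "'a set \<Rightarrow> real" and P Q
    assume *: "\<forall>f::nat \<Rightarrow> real. (\<forall>i<?n. \<forall>j<?n. spec_adj (ps ! i) (ps ! j) \<longrightarrow> f i = f j) \<longrightarrow>
        (\<forall>i<?n. \<forall>j<?n. f i = f j)"
      and f: "\<forall>P\<in>set ps. \<forall>Q\<in>set ps. spec_adj P Q \<longrightarrow> f P = f Q" and PQ: "P \<in> set ps" "Q \<in> set ps"
    have "\<forall>i<?n. \<forall>j<?n. f (ps ! i) = f (ps ! j)"
      by (rule *[THEN spec, of "\<lambda>i. f (ps ! i)", THEN mp]) (use f in auto)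
    then show "f P = f Q"
      using PQ by (auto simp: in_set_conv_nth)
  next
    fix f :: "nat \<Rightarrow> real" and i j
    assume *: "\<forall>f::'a set \<Rightarrow> real. (\<forall>P\<in>set ps. \<forall>Q\<in>set ps. spec_adj P Q \<longrightarrow> f P = f Q) \<longrightarrow>
        (\<forall>P\<in>set ps. \<forall>Q\<in>set ps. f P = f Q)"
      and f: "\<forall>i<?n. \<forall>j<?n. spec_adj (ps ! i) (ps ! j) \<longrightarrow> f i = f j"
      and ij: "i < ?n" "j < ?n"
    \<comment> \<open>\<open>f\<close> transported to the vertices, along the inverse of the enumeration \<open>ps\<close>.\<close>
    define g where "g P = f (the_inv_into {..<?n} ((!) ps) P)" for P
    have g: "g (ps ! k) = f k" if "k < ?n" for k
      unfolding g_def using distinct that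
      by (subst the_inv_into_f_f) (auto simp: inj_on_nth)
    have "\<forall>P\<in>set ps. \<forall>Q\<in>set ps. g P = g Q"
      by (rule *[THEN spec, of g, THEN mp]) (use f g in \<open>auto simp: in_set_conv_nth\<close>)
    then have "g (ps ! i) = g (ps ! j)"
      using ij by simp
    then show "f i = f j"
      using ij g by simp
  qed
  finally show ?thesis .
qed

end

section \<open>Connectedness of a finite spectrum\<close>

context ternary_gamma_semiring
begin

text \<open>An upper set is the union of the sets \<open>V(P)\<close> over its members \<open>P\<close>, and here that union is
  finite.\<close>

lemma closedin_gamma_Spec_finite_iff:
  assumes fin: "finite (gamma_Spec T G u)" and C: "C \<subseteq> gamma_Spec T G u"
  shows "closedin (gamma_Spec_topology T G u) C \<longleftrightarrow>
    (\<forall>P\<in>C. \<forall>Q\<in>gamma_Spec T G u. P \<subseteq> Q \<longrightarrow> Q \<in> C)"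
proof
  assume "closedin (gamma_Spec_topology T G u) C"
  then show "\<forall>P\<in>C. \<forall>Q\<in>gamma_Spec T G u. P \<subseteq> Q \<longrightarrow> Q \<in> C"
    unfolding closedin_gamma_Spec gamma_V_def by blast
next
  assume "\<forall>P\<in>C. \<forall>Q\<in>gamma_Spec T G u. P \<subseteq> Q \<longrightarrow> Q \<in> C"
  then have "C = \<Union> (gamma_V T G u ` C)"
    using C by (auto simp: gamma_V_def)
  moreover have "closedin (gamma_Spec_topology T G u) (gamma_V T G u P)" if "P \<in> C" for P
    unfolding closedin_gamma_Spec
    using that C by (auto simp: gamma_Spec_def prime_gamma_ideal_def)
  then have "closedin (gamma_Spec_topology T G u) (\<Union> (gamma_V T G u ` C))"
    using finite_subset[OF C fin] by (intro closedin_Union) auto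
  ultimately show "closedin (gamma_Spec_topology T G u) C"
    by simp
qed

text \<open>A clopen set is an upper set whose complement is an upper set too, so membership in it agrees
  for comparable primes, and these are the adjacent ones.\<close>

lemma clopen_gamma_Spec_finite_iff:
  assumes fin: "finite (gamma_Spec T G u)" and C: "C \<subseteq> gamma_Spec T G u"
  shows "openin (gamma_Spec_topology T G u) C \<and> closedin (gamma_Spec_topology T G u) C \<longleftrightarrow>
    (\<forall>P\<in>gamma_Spec T G u. \<forall>Q\<in>gamma_Spec T G u. spec_adj P Q \<longrightarrow> (P \<in> C \<longleftrightarrow> Q \<in> C))"
proof -
  let ?X = "gamma_Spec T G u"
  have "openin (gamma_Spec_topology T G u) C \<longleftrightarrow> (\<forall>P\<in>?X - C. \<forall>Q\<in>?X. P \<subseteq> Q \<longrightarrow> Q \<in> ?X - C)"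
    using C by (simp add: openin_closedin_eq topspace_gamma_Spec closedin_gamma_Spec_finite_iff[OF fin])
  also have "\<dots> \<longleftrightarrow> (\<forall>P\<in>?X. \<forall>Q\<in>?X. P \<subseteq> Q \<longrightarrow> Q \<in> C \<longrightarrow> P \<in> C)"
    by auto
  finally have "openin (gamma_Spec_topology T G u) C \<longleftrightarrow>
      (\<forall>P\<in>?X. \<forall>Q\<in>?X. P \<subseteq> Q \<longrightarrow> Q \<in> C \<longrightarrow> P \<in> C)" .
  moreover have "closedin (gamma_Spec_topology T G u) C \<longleftrightarrow>
      (\<forall>P\<in>?X. \<forall>Q\<in>?X. P \<subseteq> Q \<longrightarrow> P \<in> C \<longrightarrow> Q \<in> C)"
    unfolding closedin_gamma_Spec_finite_iff[OF assms] using C by auto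
  ultimately have "openin (gamma_Spec_topology T G u) C \<and> closedin (gamma_Spec_topology T G u) C \<longleftrightarrow>
      (\<forall>P\<in>?X. \<forall>Q\<in>?X. P \<subseteq> Q \<longrightarrow> (P \<in> C \<longleftrightarrow> Q \<in> C))"
    by metis
  also have "\<dots> \<longleftrightarrow> (\<forall>P\<in>?X. \<forall>Q\<in>?X. spec_adj P Q \<longrightarrow> (P \<in> C \<longleftrightarrow> Q \<in> C))"
    unfolding spec_adj_def by metis
  finally show ?thesis .
qed

text \<open>Level sets turn functions into clopen sets, and indicator functions lead back.\<close>

theorem connected_gamma_Spec_iff:
  assumes fin: "finite (gamma_Spec T G u)"
  shows "connected_space (gamma_Spec_topology T G u) \<longleftrightarrow>
    graph_connected (gamma_Spec T G u) spec_adj"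
proof -
  let ?X = "gamma_Spec T G u"
  have "connected_space (gamma_Spec_topology T G u) \<longleftrightarrow>
    (\<forall>C\<subseteq>?X. (\<forall>P\<in>?X. \<forall>Q\<in>?X. spec_adj P Q \<longrightarrow> (P \<in> C \<longleftrightarrow> Q \<in> C)) \<longrightarrow> C = {} \<or> C = ?X)"
    unfolding connected_space_clopen_in topspace_gamma_Spec
  proof (rule iff_allI)
    fix C
    have "C \<subseteq> ?X" if "closedin (gamma_Spec_topology T G u) C"
      using closedin_subset[OF that] by (simp only: topspace_gamma_Spec)
    then show "(openin (gamma_Spec_topology T G u) C \<and> closedin (gamma_Spec_topology T G u) C
          \<longrightarrow> C = {} \<or> C = ?X) \<longleftrightarrow>
        (C \<subseteq> ?X \<longrightarrow> (\<forall>P\<in>?X. \<forall>Q\<in>?X. spec_adj P Q \<longrightarrow> (P \<in> C \<longleftrightarrow> Q \<in> C))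
          \<longrightarrow> C = {} \<or> C = ?X)"
      using clopen_gamma_Spec_finite_iff[OF fin, of C] by argo
  qed
  also have "\<dots> \<longleftrightarrow> graph_connected ?X spec_adj"
    unfolding graph_connected_def
  proof (intro iffI allI impI ballI)
    fix f :: "'a set \<Rightarrow> real" and P Q
    assume *: "\<forall>C\<subseteq>?X. (\<forall>P\<in>?X. \<forall>Q\<in>?X. spec_adj P Q \<longrightarrow> (P \<in> C \<longleftrightarrow> Q \<in> C)) \<longrightarrow> C = {} \<or> C = ?X"
      and f: "\<forall>P\<in>?X. \<forall>Q\<in>?X. spec_adj P Q \<longrightarrow> f P = f Q" and PQ: "P \<in> ?X" "Q \<in> ?X"
    have "{R \<in> ?X. f R = f P} = {} \<or> {R \<in> ?X. f R = f P} = ?X"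
      by (intro *[rule_format]) (use f in auto)
    then show "f P = f Q"
      using PQ by force
  next
    fix C
    assume *: "\<forall>f::'a set \<Rightarrow> real. (\<forall>P\<in>?X. \<forall>Q\<in>?X. spec_adj P Q \<longrightarrow> f P = f Q) \<longrightarrow>
        (\<forall>P\<in>?X. \<forall>Q\<in>?X. f P = f Q)"
      and C: "C \<subseteq> ?X" "\<forall>P\<in>?X. \<forall>Q\<in>?X. spec_adj P Q \<longrightarrow> (P \<in> C \<longleftrightarrow> Q \<in> C)"
    have "\<forall>P\<in>?X. \<forall>Q\<in>?X. (of_bool (P \<in> C) :: real) = of_bool (Q \<in> C)"
      by (rule *[THEN spec, of "\<lambda>P. of_bool (P \<in> C)", THEN mp]) (use C(2) in auto)
    then show "C = {} \<or> C = ?X"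
      using C(1) by (simp only: of_bool_eq_iff) blast
  qed
  finally show ?thesis .
qed

end

theorem theorem10:
  fixes T :: "('a, 'm) ring_scheme"
    and G :: "('g, 'n) monoid_scheme"
    and u :: "'g \<Rightarrow> 'a"
    and ps :: "'a set list"
  assumes "ternary_gamma_semiring T G u"
    and "finite (gamma_Spec T G u)"
    and "distinct ps" and "set ps = gamma_Spec T G u"
  shows "connected_space (gamma_Spec_topology T G u) \<longleftrightarrow> lambda2 (laplacian_mat ps) > 0"
  using ternary_gamma_semiring.connected_gamma_Spec_iff[OF assms(1,2)]
    lambda2_laplacian_pos_iff[OF assms(3)] assms(4)
  by simp

end
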